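(* Let $\rho>0$. Suppose $g$ is $\rho$-weakly convex, $x\mapsto f(x)-\frac{\rho}{2}\|x\|_2^2$ is convex, the set of minimizers of $h=f+g$ is non-empty, and $\alpha>0$ is a constant such that $\alpha<1/\rho$. Let $$\beta_1=\frac{\alpha}{1+\alpha\rho},\qquad \beta_2=\frac{\alpha}{1-\alpha\rho},$$ $$K_1(x)=J_{\beta_1 g}\Bigl(\frac{\beta_1}{\alpha}x\Bigr),\qquad K_2(x)=J_{\beta_2 f}\Bigl(\frac{\beta_2}{\alpha}x\Bigr),$$ and suppose $0<\lambda<1$. Then: (a) the sequence defined (from any starting point $z^0\in\mathbb{R}^n$) by $$z^{k+1}=\Bigl((1-\lambda)I+\lambda(2K_2-I)(2K_1-I)\Bigr)(z^k)$$ converges to some $z^*$ such that $K_1(z^* )$ minimizes $h$; (b) the sequence defined (from any starting point $z^0\in\mathbb{R}^n$) by $$z^{k+1}=\Bigl((1-\lambda)I+\lambda(2K_1-I)(2K_2-I)\Bigr)(z^k)$$ converges to some $z^*$ such that $K_2(z^* )$ minimizes $h$.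
   Context: $f$ and $g$ are functions on $\mathbb{R}^n$; $f$ is not required to be smooth, and in particular it may contain characteristic functions of sets (equal to $0$ on the set and $+\infty$ off it). A function $g:\mathbb{R}^n\to\mathbb{R}$ is $\rho$-weakly convex if $x\mapsto g(x)+\frac{s}{2}\|x\|_2^2$ is convex for $s\ge\rho$. For $\beta>0$, the proximity operator of a function $q$ on $\mathbb{R}^n$ is $J_{\beta q}(x)=\arg\min_z \frac{1}{2\beta}\|z-x\|_2^2+q(z)$. $I$ is the identity on $\mathbb{R}^n$, and juxtaposition of operators denotes composition.
   Formalization: The formal statement additionally assumes that the minimum defining J_{β₂f}(x) is attained for every x (true if f is lower semicontinuous); otherwise K₂ may be undefined, e.g. f = (ρ/2)‖x‖² plus the characteristic function of an open ball. *)

theory Defs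
  imports "HOL-Analysis.Analysis"
begin

text \<open>
  Functions that may take the value \<open>+\<infinity>\<close> (for instance because they contain characteristic
  functions of sets) are functions into \<^typ>\<open>ereal\<close> that avoid \<open>-\<infinity>\<close>. For such functions the
  right-hand side below is never of the form \<open>\<infinity> - \<infinity>\<close>; the convention \<open>0 * \<infinity> = 0\<close> of
  \<^typ>\<open>ereal\<close> makes the cases \<open>t = 0\<close> and \<open>t = 1\<close> trivially true.
\<close>

definition ereal_convex :: "('a::real_vector \<Rightarrow> ereal) \<Rightarrow> bool" where
  "ereal_convex q \<longleftrightarrow>
     (\<forall>x y. \<forall>t\<in>{0..1}. q ((1 - t) *\<^sub>R x + t *\<^sub>R y) \<le> ereal (1 - t) * q x + ereal t * q y)"

definition weakly_convex :: "real \<Rightarrow> ('a::real_normed_vector \<Rightarrow> real) \<Rightarrow> bool" where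
  "weakly_convex \<rho> g \<longleftrightarrow> (\<forall>s\<ge>\<rho>. convex_on UNIV (\<lambda>x. g x + s / 2 * (norm x)\<^sup>2))"

definition minimizers :: "('a \<Rightarrow> ereal) \<Rightarrow> 'a set" where
  "minimizers h = {x. is_arg_min h (\<lambda>_. True) x}"

definition prox_objective ::
    "real \<Rightarrow> ('a::real_normed_vector \<Rightarrow> ereal) \<Rightarrow> 'a \<Rightarrow> 'a \<Rightarrow> ereal" where
  "prox_objective \<beta> q x z = ereal (1 / (2 * \<beta>) * (norm (z - x))\<^sup>2) + q z"

text \<open>
  \<^const>\<open>arg_min\<close> picks some minimizer; it is unspecified if there is none. That there is one for
  every \<open>x\<close> is expressed by \<open>prox_defined\<close>.
\<close>

definition prox :: "real \<Rightarrow> ('a::real_normed_vector \<Rightarrow> ereal) \<Rightarrow> 'a \<Rightarrow> 'a" where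
  "prox \<beta> q x = arg_min (prox_objective \<beta> q x) (\<lambda>_. True)"

definition prox_defined :: "real \<Rightarrow> ('a::real_normed_vector \<Rightarrow> ereal) \<Rightarrow> bool" where
  "prox_defined \<beta> q \<longleftrightarrow> (\<forall>x. minimizers (prox_objective \<beta> q x) \<noteq> {})"

definition reflected :: "('a::real_vector \<Rightarrow> 'a) \<Rightarrow> 'a \<Rightarrow> 'a" where
  "reflected K x = 2 *\<^sub>R K x - x"


text \<open>
  Being \<open>prox_defined\<close> is weaker than the usual assumption of lower semicontinuity: a convex function
  into \<open>(-\<infinity>, \<infinity>]\<close> with closed sublevel sets has an everywhere defined proximity operator.
\<close>

lemma closed_sublevel_attains_inf:
  fixes q :: "'a::topological_space \<Rightarrow> ereal"
  assumes C: "compact C" "C \<noteq> {}" and cl: "\<And>a. closed {x. q x \<le> a}"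
  shows "\<exists>z\<in>C. \<forall>y\<in>C. q z \<le> q y"
proof (rule ccontr)
  assume neg: "\<not> ?thesis"
  have op: "open {x. q y < q x}" for y
  proof -
    have "{x. q y < q x} = - {x. q x \<le> q y}" by auto
    then show ?thesis using cl[of "q y"] by (simp add: open_Compl)
  qed
  have cov: "C \<subseteq> (\<Union>y\<in>C. {x. q y < q x})"
    using neg by (auto simp: not_le)
  obtain D where D: "D \<subseteq> C" "finite D" "C \<subseteq> (\<Union>y\<in>D. {x. q y < q x})"
    using compactE_image[OF C(1) _ cov] op by blast
  have "D \<noteq> {}" using D(3) C(2) by auto
  define y0 where "y0 = arg_min_on q D"
  have y0: "y0 \<in> D" "\<And>y. y \<in> D \<Longrightarrow> q y0 \<le> q y"
    unfolding y0_def
    using arg_min_if_finite(1)[OF D(2) \<open>D \<noteq> {}\<close>] arg_min_least[OF D(2) \<open>D \<noteq> {}\<close>] by auto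
  then obtain y where "y \<in> D" "q y < q y0" using D(1,3) by blast
  with y0(2)[of y] show False by simp
qed

lemma closed_sublevel_prox_objective:
  fixes q :: "'a::real_normed_vector \<Rightarrow> ereal"
  assumes ninf: "\<And>x. q x \<noteq> -\<infinity>" and cl: "\<And>a. closed {x. q x \<le> a}"
  shows "closed {z. prox_objective \<beta> q x z \<le> a}"
proof (cases a)
  case PInf then show ?thesis by simp
next
  case MInf
  have "{z. prox_objective \<beta> q x z \<le> a} = {}"
    using ninf MInf by (auto simp: prox_objective_def)
  then show ?thesis by simp
next
  case (real r)
  define c where "c z = 1 / (2 * \<beta>) * (norm (z - x))\<^sup>2" for z
  have iff: "prox_objective \<beta> q x z \<le> a \<longleftrightarrow> q z \<le> ereal (r - c z)" for z
    using ninf[of z] by (cases "q z") (auto simp: prox_objective_def c_def real)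
  show ?thesis unfolding iff closed_sequential_limits
  proof safe
    fix X l assume X: "\<forall>n. X n \<in> {z. q z \<le> ereal (r - c z)}" and lim: "X \<longlonglongrightarrow> l"
    have cl': "(\<lambda>n. r - c (X n)) \<longlonglongrightarrow> r - c l"
      unfolding c_def by (intro tendsto_intros lim)
    have "q l \<le> ereal (r - c l) + ereal e" if "e > 0" for e
    proof -
      have "eventually (\<lambda>n. r - c (X n) < r - c l + e) sequentially"
        by (rule order_tendstoD(2)[OF cl']) (use that in linarith)
      then have ev: "eventually (\<lambda>n. X n \<in> {z. q z \<le> ereal (r - c l + e)}) sequentially"
      proof eventually_elim
        case (elim n)
        have "q (X n) \<le> ereal (r - c (X n))" using X by simp
        also have "\<dots> \<le> ereal (r - c l + e)" using elim by simp
        finally show ?case by simp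
      qed
      have "l \<in> {z. q z \<le> ereal (r - c l + e)}"
        by (rule Lim_in_closed_set[OF cl ev _ lim]) simp
      then show ?thesis by simp
    qed
    then show "q l \<le> ereal (r - c l)"
      using ereal_le_epsilon2[of "q l" "ereal (r - c l)"] by blast
  qed
qed

lemma prox_defined_closed_convex:
  fixes q :: "'a::euclidean_space \<Rightarrow> ereal"
  assumes \<beta>: "\<beta> > 0" and ninf: "\<And>x. q x \<noteq> -\<infinity>" and conv: "ereal_convex q"
    and cl: "\<And>a. closed {x. q x \<le> a}"
  shows "prox_defined \<beta> q"
  unfolding prox_defined_def
proof
  fix x
  let ?Q = "prox_objective \<beta> q x"
  show "minimizers ?Q \<noteq> {}"
  proof (cases "\<forall>z. q z = \<infinity>")
    case True
    then show ?thesis by (auto simp: minimizers_def is_arg_min_def prox_objective_def)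
  next
    case False
    then obtain x0 where "q x0 \<noteq> \<infinity>" by auto
    then obtain a where a: "q x0 = ereal a" using ninf[of x0] by (cases "q x0") auto
    obtain p where p: "p \<in> cball x0 1" "\<And>y. y \<in> cball x0 1 \<Longrightarrow> q p \<le> q y"
      using closed_sublevel_attains_inf[of "cball x0 1" q] cl by auto
    have "q p \<le> ereal a" using p(2)[of x0] a by simp
    then obtain m where m: "q p = ereal m" "m \<le> a" using ninf[of p] by (cases "q p") auto
    have lower: "ereal (m - norm (z - x0) * (a - m)) \<le> q z" for z
    proof (cases "norm (z - x0) \<le> 1")
      case True
      then have "ereal m \<le> q z" using p(2)[of z] m by (simp add: dist_norm norm_minus_commute)
      moreover have "m - norm (z - x0) * (a - m) \<le> m" using m by simp
      ultimately show ?thesis by (meson ereal_less_eq(3) order_trans)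
    next
      case far: False
      define d where "d = norm (z - x0)"
      define t where "t = 1 / d"
      have d: "d > 1" using far d_def by simp
      have t: "t \<in> {0..1}" "t > 0" using d by (auto simp: t_def)
      define y where "y = (1 - t) *\<^sub>R x0 + t *\<^sub>R z"
      have "y - x0 = t *\<^sub>R (z - x0)" by (simp add: y_def algebra_simps)
      then have "norm (y - x0) = \<bar>t\<bar> * d" by (simp add: d_def)
      then have "norm (y - x0) = 1" using d by (simp add: t_def)
      then have "ereal m \<le> q y" using p(2)[of y] m by (simp add: dist_norm norm_minus_commute)
      also have "q y \<le> ereal (1 - t) * q x0 + ereal t * q z"
        using conv t unfolding ereal_convex_def y_def by blast
      finally have le: "ereal m \<le> ereal (1 - t) * ereal a + ereal t * q z" by (simp add: a)
      show ?thesis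
      proof (cases "q z")
        case (real r)
        have "m \<le> (1 - t) * a + t * r" using le real by simp
        then have "d * m \<le> d * ((1 - t) * a + t * r)" using d by (simp add: mult_left_mono)
        also have "\<dots> = d * a - a + r" using d by (simp add: t_def field_simps)
        finally have "a - d * (a - m) \<le> r" by (simp add: algebra_simps)
        then show ?thesis using m real by (simp add: d_def)
      qed (use ninf in auto)
    qed
    define b where "b = 1 / (2 * \<beta>) * (norm (x0 - x))\<^sup>2 + a"
    have b: "?Q x0 = ereal b" by (simp add: prox_objective_def a b_def)
    let ?C = "{z. ?Q z \<le> ereal b}"
    define k where "k = a - m"
    define e where "e = norm (x - x0)"
    define A where "A = 2 * \<beta> * k"
    define B where "B = 2 * \<beta> * (\<bar>b - m\<bar> + e * k)"
    have nn: "k \<ge> 0" "e \<ge> 0" "A \<ge> 0" "B \<ge> 0"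
      using \<beta> m by (simp_all add: k_def e_def A_def B_def)
    have "?C \<subseteq> cball x (A + B + 1)"
    proof
      fix z assume z: "z \<in> ?C"
      define w where "w = norm (z - x)"
      obtain r where r: "q z = ereal r"
        using z ninf[of z] by (cases "q z") (auto simp: prox_objective_def)
      have 1: "1 / (2 * \<beta>) * w\<^sup>2 + r \<le> b" using z r by (simp add: prox_objective_def w_def)
      have 2: "m - norm (z - x0) * k \<le> r" using lower[of z] r by (simp add: k_def)
      have "norm (z - x0) \<le> w + e"
        unfolding w_def e_def using norm_triangle_ineq[of "z - x" "x - x0"] by simp
      then have "norm (z - x0) * k \<le> (w + e) * k" using nn by (simp add: mult_right_mono)
      with 1 2 have "1 / (2 * \<beta>) * w\<^sup>2 \<le> \<bar>b - m\<bar> + (w + e) * k" by linarith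
      then have sq: "w * w \<le> A * w + B"
        using \<beta> by (simp add: A_def B_def field_simps power2_eq_square)
      have "w \<le> A + B + 1"
      proof (rule ccontr)
        assume "\<not> ?thesis"
        then have w: "w > A + B + 1" by simp
        then have "w \<ge> 1" using nn by simp
        then have "A * w + B < (A + B + 1) * w"
          using nn mult_left_mono[of 1 w B] by (simp add: algebra_simps)
        also have "\<dots> \<le> w * w" using w \<open>w \<ge> 1\<close> by (intro mult_right_mono) auto
        finally show False using sq by simp
      qed
      then show "z \<in> cball x (A + B + 1)" by (simp add: w_def dist_norm norm_minus_commute)
    qed
    then have "bounded ?C" using bounded_cball bounded_subset by blast
    moreover have cl': "closed {z. ?Q z \<le> r}" for r
      using closed_sublevel_prox_objective[OF ninf cl] .
    ultimately have C: "compact ?C" by (simp only: compact_eq_bounded_closed simp_thms)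
    have "x0 \<in> ?C" using b by simp
    then have "?C \<noteq> {}" by blast
    from closed_sublevel_attains_inf[OF C this cl']
    obtain z where z: "z \<in> ?C" "\<And>y. y \<in> ?C \<Longrightarrow> ?Q z \<le> ?Q y" by blast
    have "?Q z \<le> ?Q y" for y
    proof (cases "?Q y \<le> ereal b")
      case True
      then show ?thesis using z(2)[of y] by simp
    next
      case False
      then have "ereal b \<le> ?Q y" by simp
      with z(1) show ?thesis by (metis mem_Collect_eq order_trans)
    qed
    then show ?thesis by (auto simp: minimizers_def is_arg_min_def not_less)
  qed
qed

end

theory Submission
  imports Defs
begin

text \<open>
  Completing the square turns \<open>K\<^sub>1\<close> and \<open>K\<^sub>2\<close> into the proximity operators, both with parameter \<open>\<alpha>\<close>,
  of the convex functions \<open>G = g + \<rho>/2 \<parallel>\<cdot>\<parallel>\<^sup>2\<close> and \<open>F = f - \<rho>/2 \<parallel>\<cdot>\<parallel>\<^sup>2\<close>, whose sum is still \<open>h\<close>. So the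
  iterations are the classical Douglas-Rachford iterations for \<open>F + G\<close>: the reflected resolvents of
  the monotone relations \<open>\<partial>F\<close> and \<open>\<partial>G\<close> are nonexpansive, the Krasnoselskii-Mann iteration of their
  composition converges to a fixed point, and at a fixed point the two resolvents return the same
  point together with opposite subgradients. A fixed point exists because at a minimizer of \<open>h\<close> a
  hyperplane separating the epigraph of \<open>G\<close> from the hypograph of
  \<open>min h - F\<close> provides opposite subgradients.
\<close>

section \<open>Averaged iterations of nonexpansive maps\<close>

lemma norm_convex_combination_sq:
  fixes a b :: "'a::real_inner"
  shows "(norm ((1 - t) *\<^sub>R a + t *\<^sub>R b))\<^sup>2
    = (1 - t) * (norm a)\<^sup>2 + t * (norm b)\<^sup>2 - t * (1 - t) * (norm (b - a))\<^sup>2"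
  by (simp add: power2_norm_eq_inner algebra_simps inner_commute)

text \<open>The negative term of the convex combination identity makes the squared distance to any
  fixed point drop by at least \<open>lam * (1 - lam)\<close> times the squared residual. Hence the
  residuals vanish, the iterates stay bounded, and by continuity every cluster point is
  fixed.\<close>

lemma krasnoselskii_mann:
  fixes T :: "'a::euclidean_space \<Rightarrow> 'a"
  assumes nonexp: "\<And>x y. norm (T x - T y) \<le> norm (x - y)" and fp: "T y0 = y0"
    and lam: "0 < lam" "lam < 1"
    and z: "\<And>k. z (Suc k) = (1 - lam) *\<^sub>R z k + lam *\<^sub>R T (z k)"
  shows "\<exists>z'. z \<longlonglongrightarrow> z' \<and> T z' = z'"
proof -
  define r where "r k = (norm (T (z k) - z k))\<^sup>2" for k
  have desc: "(norm (z (Suc k) - y))\<^sup>2 \<le> (norm (z k - y))\<^sup>2 - lam * (1 - lam) * r k"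
    if y: "T y = y" for y k
  proof -
    have "z (Suc k) - y = (1 - lam) *\<^sub>R (z k - y) + lam *\<^sub>R (T (z k) - y)"
      by (simp add: z algebra_simps)
    then have "(norm (z (Suc k) - y))\<^sup>2 =
      (1 - lam) * (norm (z k - y))\<^sup>2 + lam * (norm (T (z k) - y))\<^sup>2 - lam * (1 - lam) * r k"
      by (simp add: norm_convex_combination_sq r_def)
    moreover have "(norm (T (z k) - y))\<^sup>2 \<le> (norm (z k - y))\<^sup>2"
      using nonexp[of "z k" y] y by (simp add: power_mono)
    then have "lam * (norm (T (z k) - y))\<^sup>2 \<le> lam * (norm (z k - y))\<^sup>2"
      using lam by simp
    ultimately show ?thesis by (simp add: algebra_simps)
  qed
  have dec: "decseq (\<lambda>k. norm (z k - y))" if "T y = y" for y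
  proof (rule decseq_SucI)
    fix k
    have "0 \<le> lam * (1 - lam) * r k" using lam by (simp add: r_def)
    then have "(norm (z (Suc k) - y))\<^sup>2 \<le> (norm (z k - y))\<^sup>2" using desc[OF that, of k] by linarith
    then show "norm (z (Suc k) - y) \<le> norm (z k - y)" by (rule power2_le_imp_le) simp
  qed
  define a where "a k = (norm (z k - y0))\<^sup>2" for k
  have "decseq a"
    unfolding a_def using dec[OF fp] by (auto simp: decseq_def intro!: power_mono)
  then obtain L where L: "a \<longlonglongrightarrow> L"
    using decseq_convergent[of a 0] by (auto simp: a_def)
  \<comment> \<open>The drops of the convergent sequence \<open>a\<close> tend to 0, and they
    dominate the residuals up to the factor \<open>lam * (1 - lam)\<close>.\<close>
  have "(\<lambda>k. a k - a (Suc k)) \<longlonglongrightarrow> L - L"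
    by (intro tendsto_diff L LIMSEQ_Suc)
  then have lim: "(\<lambda>k. (a k - a (Suc k)) / (lam * (1 - lam))) \<longlonglongrightarrow> 0"
    using tendsto_divide_zero by force
  have "norm (r k) \<le> (a k - a (Suc k)) / (lam * (1 - lam))" for k
    using desc[OF fp, of k] lam by (simp add: r_def a_def field_simps)
  then have "r \<longlonglongrightarrow> 0" by (intro Lim_null_comparison[OF _ lim]) simp
  then have "(\<lambda>k. sqrt (r k)) \<longlonglongrightarrow> sqrt 0" by (rule tendsto_real_sqrt)
  then have res: "(\<lambda>k. T (z k) - z k) \<longlonglongrightarrow> 0"
    by (simp add: r_def tendsto_norm_zero_iff)
  have "bounded (range z)"
  proof (rule boundedI)
    fix x assume "x \<in> range z"
    then obtain k where k: "x = z k" by auto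
    have "norm (z k - y0) \<le> norm (z 0 - y0)"
      using dec[OF fp] by (auto simp: decseq_def)
    then show "norm x \<le> norm (z 0 - y0) + norm y0"
      using norm_triangle_sub[of x y0] k by simp
  qed
  then obtain z' s where s: "strict_mono s" and lim: "(z \<circ> s) \<longlonglongrightarrow> z'"
    using bounded_imp_convergent_subsequence by blast
  have "continuous_on UNIV T"
    by (rule continuous_onI) (metis nonexp dist_norm le_less_trans order_less_imp_le)
  then have "(\<lambda>k. T (z (s k))) \<longlonglongrightarrow> T z'"
    using continuous_on_tendsto_compose[of UNIV T, OF _ lim] by (simp add: o_def)
  then have "(\<lambda>k. T (z (s k)) - z (s k)) \<longlonglongrightarrow> T z' - z'"
    using lim by (intro tendsto_diff) (auto simp: o_def)
  moreover have "(\<lambda>k. T (z (s k)) - z (s k)) \<longlonglongrightarrow> 0"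
    using LIMSEQ_subseq_LIMSEQ[OF res s] by (simp add: o_def)
  ultimately have fz: "T z' = z'" using LIMSEQ_unique by fastforce
  \<comment> \<open>The cluster point \<open>z'\<close> is itself a fixed point, so the distance to
    it decreases along the whole sequence; the subsequence identifies its limit as 0.\<close>
  obtain M where M: "(\<lambda>k. norm (z k - z')) \<longlonglongrightarrow> M"
    using decseq_convergent[OF dec[OF fz], of 0] by auto
  have "(\<lambda>k. norm (z (s k) - z')) \<longlonglongrightarrow> M"
    using LIMSEQ_subseq_LIMSEQ[OF M s] by (simp add: o_def)
  moreover have "(\<lambda>k. norm (z (s k) - z')) \<longlonglongrightarrow> 0"
    using lim by (simp add: o_def tendsto_norm_zero_iff LIM_zero_iff)
  ultimately have "M = 0" by (rule LIMSEQ_unique)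
  with M have "z \<longlonglongrightarrow> z'" by (simp add: tendsto_norm_zero_iff LIM_zero_iff)
  with fz show ?thesis by blast
qed

section \<open>Monotone relations, resolvents and Douglas-Rachford splitting\<close>

text \<open>A set-valued operator is encoded as a binary predicate: \<open>A p u\<close> means that
  \<open>u\<close> is one of its values at \<open>p\<close>.\<close>

definition monotone_rel :: "('a::real_inner \<Rightarrow> 'a \<Rightarrow> bool) \<Rightarrow> bool" where
  "monotone_rel A \<longleftrightarrow> (\<forall>p u q v. A p u \<longrightarrow> A q v \<longrightarrow> 0 \<le> (u - v) \<bullet> (p - q))"

text \<open>\<open>K\<close> is an everywhere defined selection of the inverse of the identity plus
  \<alpha> times \<open>A\<close>. For monotone \<open>A\<close> and positive \<alpha> it is the
  only one, by \<open>resolvent_eqI\<close>.\<close>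

definition resolvent :: "real \<Rightarrow> ('a::real_vector \<Rightarrow> 'a \<Rightarrow> bool) \<Rightarrow> ('a \<Rightarrow> 'a) \<Rightarrow> bool" where
  "resolvent \<alpha> A K \<longleftrightarrow> (\<forall>x. A (K x) ((1 / \<alpha>) *\<^sub>R (x - K x)))"

lemma resolvent_firmly_nonexpansive:
  assumes "monotone_rel A" "resolvent \<alpha> A K" "\<alpha> > 0"
  shows "(norm (K x - K y))\<^sup>2 \<le> (x - y) \<bullet> (K x - K y)"
proof -
  have "0 \<le> ((1 / \<alpha>) *\<^sub>R (x - K x) - (1 / \<alpha>) *\<^sub>R (y - K y)) \<bullet> (K x - K y)"
    using assms by (auto simp: monotone_rel_def resolvent_def)
  also have "\<dots> = (1 / \<alpha>) * (((x - y) - (K x - K y)) \<bullet> (K x - K y))"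
    by (simp add: algebra_simps add_divide_distrib diff_divide_distrib)
  finally have "0 \<le> ((x - y) - (K x - K y)) \<bullet> (K x - K y)"
    using assms(3) by (simp add: zero_le_mult_iff zero_le_divide_iff)
  then show ?thesis by (simp add: inner_diff_left[of "x - y"] power2_norm_eq_inner)
qed

text \<open>Expanding the square, the loss in squared distance is exactly four times the slack in
  firm nonexpansiveness.\<close>

lemma reflected_nonexpansive:
  assumes "monotone_rel A" "resolvent \<alpha> A K" "\<alpha> > 0"
  shows "norm (reflected K x - reflected K y) \<le> norm (x - y)"
proof (rule power2_le_imp_le)
  define d where "d = K x - K y"
  have "reflected K x - reflected K y = 2 *\<^sub>R d - (x - y)"
    by (simp add: reflected_def d_def algebra_simps)
  then have "(norm (reflected K x - reflected K y))\<^sup>2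
      = (norm (x - y))\<^sup>2 - 4 * ((x - y) \<bullet> d - (norm d)\<^sup>2)"
    by (simp only: power2_norm_eq_inner) (simp add: inner_diff inner_commute algebra_simps)
  then show "(norm (reflected K x - reflected K y))\<^sup>2 \<le> (norm (x - y))\<^sup>2"
    using resolvent_firmly_nonexpansive[OF assms, of x y] by (simp add: d_def)
qed simp

text \<open>At \<open>x = p + \<alpha> *\<^sub>R u\<close> the two values of \<open>A\<close> differ
  by a negative multiple of \<open>K x - p\<close>, so monotonicity forces \<open>K x - p\<close> to
  vanish.\<close>

lemma resolvent_eqI:
  assumes "monotone_rel A" "resolvent \<alpha> A K" "\<alpha> > 0" "A p u"
  shows "K (p + \<alpha> *\<^sub>R u) = p"
proof -
  define x where "x = p + \<alpha> *\<^sub>R u"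
  have "0 \<le> ((1 / \<alpha>) *\<^sub>R (x - K x) - u) \<bullet> (K x - p)"
    using assms by (auto simp: monotone_rel_def resolvent_def)
  also have "(1 / \<alpha>) *\<^sub>R (x - K x) - u = - ((1 / \<alpha>) *\<^sub>R (K x - p))"
    using assms(3) by (simp add: x_def algebra_simps)
  finally have "(1 / \<alpha>) * ((K x - p) \<bullet> (K x - p)) \<le> 0" by simp
  then have "(K x - p) \<bullet> (K x - p) \<le> 0" using assms(3) by (simp add: mult_le_0_iff divide_le_0_iff)
  then have "K x - p = 0" by (metis inner_eq_zero_iff inner_ge_zero order_antisym)
  then show ?thesis by (simp add: x_def)
qed

text \<open>Arbitrary monotone relations are allowed so that the roles of the two summands can be
  swapped and a degenerate \<open>f\<close> can be treated as well.\<close>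

lemma douglas_rachford:
  fixes A B :: "'a::euclidean_space \<Rightarrow> 'a \<Rightarrow> bool"
  assumes A: "monotone_rel A" "resolvent \<alpha> A K" and B: "monotone_rel B" "resolvent \<alpha> B L"
    and \<alpha>: "\<alpha> > 0" and sol: "A p u" "B p (- u)"
    and lam: "0 < lam" "lam < 1"
    and z: "\<And>k. z (Suc k) = (1 - lam) *\<^sub>R z k + lam *\<^sub>R (reflected L \<circ> reflected K) (z k)"
  shows "\<exists>z'. z \<longlonglongrightarrow> z' \<and> (\<exists>v. A (K z') v \<and> B (K z') (- v))"
proof -
  let ?T = "reflected L \<circ> reflected K"
  have "norm (?T x - ?T y) \<le> norm (x - y)" for x y
    using reflected_nonexpansive[OF A \<alpha>, of x y]
      reflected_nonexpansive[OF B \<alpha>, of "reflected K x" "reflected K y"] by simp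
  \<comment> \<open>\<open>K\<close> sends this point to \<open>p\<close>, so its reflection is
    \<open>p - \<alpha> *\<^sub>R u\<close>; \<open>L\<close> sends that to \<open>p\<close> too,
    and the second reflection leads back.\<close>
  moreover have "?T (p + \<alpha> *\<^sub>R u) = p + \<alpha> *\<^sub>R u"
    using resolvent_eqI[OF A \<alpha> sol(1)] resolvent_eqI[OF B \<alpha> sol(2)]
    by (simp add: reflected_def scaleR_2)
  ultimately obtain z' where z': "z \<longlonglongrightarrow> z'" "?T z' = z'"
    using krasnoselskii_mann[of ?T] lam z by blast
  have "2 *\<^sub>R L (reflected K z') = 2 *\<^sub>R K z'"
    using z'(2) by (simp add: reflected_def algebra_simps)
  then have "L (reflected K z') = K z'" by simp
  moreover have "B (L (reflected K z')) ((1 / \<alpha>) *\<^sub>R (reflected K z' - L (reflected K z')))"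
    using B(2) by (auto simp: resolvent_def)
  moreover have "(1 / \<alpha>) *\<^sub>R (reflected K z' - K z') = - ((1 / \<alpha>) *\<^sub>R (z' - K z'))"
    by (simp add: reflected_def scaleR_2 algebra_simps)
  ultimately have "B (K z') (- ((1 / \<alpha>) *\<^sub>R (z' - K z')))" by simp
  moreover have "A (K z') ((1 / \<alpha>) *\<^sub>R (z' - K z'))" using A(2) by (simp add: resolvent_def)
  ultimately show ?thesis using z'(1) by blast
qed

section \<open>Subgradients and proximity operators\<close>

text \<open>Finiteness at \<open>p\<close> rules out the value \<open>-\<infinity>\<close>, where
  the inequality is trivial, and allows inequalities at two points to be added and the values
  cancelled.\<close>

definition subgradient :: "('a::real_inner \<Rightarrow> ereal) \<Rightarrow> 'a \<Rightarrow> 'a \<Rightarrow> bool" where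
  "subgradient q p u \<longleftrightarrow> \<bar>q p\<bar> \<noteq> \<infinity> \<and> (\<forall>z. q p + ereal (u \<bullet> (z - p)) \<le> q z)"

lemma monotone_subgradient: "monotone_rel (subgradient q)"
  unfolding monotone_rel_def
proof (intro allI impI)
  fix p u p' v assume p: "subgradient q p u" and p': "subgradient q p' v"
  obtain a b where ab: "q p = ereal a" "q p' = ereal b"
    using p p' by (auto simp: subgradient_def)
  have "a + u \<bullet> (p' - p) \<le> b" "b + v \<bullet> (p - p') \<le> a"
    using p p' ab unfolding subgradient_def by (metis ereal_less_eq(3) plus_ereal.simps(1))+
  then show "0 \<le> (u - v) \<bullet> (p - p')" by (simp add: inner_diff)
qed

text \<open>Fermat's rule: compare \<open>p\<close> with the point a fraction \<open>t\<close> of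
  the way to \<open>z\<close>, bound \<open>q\<close> there by convexity, divide by \<open>t\<close>
  and let \<open>t\<close> tend to 0. The finite value at \<open>x0\<close> makes \<open>q p\<close>
  finite.\<close>

lemma prox_objective_minimizer_subgradient:
  fixes q :: "'a::real_inner \<Rightarrow> ereal"
  assumes \<alpha>: "\<alpha> > 0" and conv: "ereal_convex q" and ninf: "\<And>x. q x \<noteq> -\<infinity>" and fin: "q x0 \<noteq> \<infinity>"
    and p: "p \<in> minimizers (prox_objective \<alpha> q x)"
  shows "subgradient q p ((1 / \<alpha>) *\<^sub>R (x - p))"
proof -
  have le: "prox_objective \<alpha> q x p \<le> prox_objective \<alpha> q x w" for w
    using p by (auto simp: minimizers_def is_arg_min_def not_less)
  obtain a where a: "q p = ereal a"
    using le[of x0] fin ninf[of p] by (cases "q p") (auto simp: prox_objective_def)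
  have "q p + ereal (((1 / \<alpha>) *\<^sub>R (x - p)) \<bullet> (z - p)) \<le> q z" for z
  proof (cases "q z")
    case (real r)
    define i where "i = (x - p) \<bullet> (z - p)"
    define N where "N = (norm (z - p))\<^sup>2"
    have t: "i / \<alpha> \<le> r - a + t * (N / (2 * \<alpha>))" if t: "0 < t" "t \<le> 1" for t
    proof -
      define w where "w = (1 - t) *\<^sub>R p + t *\<^sub>R z"
      have "q w \<le> ereal (1 - t) * q p + ereal t * q z"
        using conv t unfolding ereal_convex_def w_def by auto
      then have "q w \<le> ereal ((1 - t) * a + t * r)" using a real by simp
      then obtain b where b: "q w = ereal b" "b \<le> (1 - t) * a + t * r"
        using ninf[of w] by (cases "q w") auto
      have "w - x = (p - x) + t *\<^sub>R (z - p)" by (simp add: w_def algebra_simps)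
      then have "(norm (w - x))\<^sup>2 = (norm (p - x))\<^sup>2 + 2 * t * ((p - x) \<bullet> (z - p)) + t\<^sup>2 * N"
        by (simp only: power2_norm_eq_inner N_def)
          (simp add: inner_add inner_commute power2_eq_square del: inner_diff_left inner_diff_right)
      then have n: "(norm (w - x))\<^sup>2 = (norm (p - x))\<^sup>2 - 2 * t * i + t * t * N"
        by (simp add: i_def inner_diff_left power2_eq_square algebra_simps)
      have "(norm (p - x))\<^sup>2 / (2 * \<alpha>) + a \<le> (norm (w - x))\<^sup>2 / (2 * \<alpha>) + b"
        using le[of w] a b by (simp add: prox_objective_def)
      also have "\<dots> \<le> (norm (w - x))\<^sup>2 / (2 * \<alpha>) + ((1 - t) * a + t * r)" using b by simp
      also have "(norm (w - x))\<^sup>2 / (2 * \<alpha>) =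
          (norm (p - x))\<^sup>2 / (2 * \<alpha>) - t * (i / \<alpha>) + t * (t * (N / (2 * \<alpha>)))"
        using \<alpha> by (simp add: n field_simps)
      finally have "t * (i / \<alpha>) \<le> t * (r - a + t * (N / (2 * \<alpha>)))"
        by (simp add: algebra_simps)
      then show ?thesis using t by (simp only: mult_le_cancel_left_pos)
    qed
    have "((\<lambda>t. r - a + t * (N / (2 * \<alpha>))) \<longlongrightarrow> r - a + 0 * (N / (2 * \<alpha>))) (at_right 0)"
      by (intro tendsto_intros)
    moreover have "eventually (\<lambda>t. i / \<alpha> \<le> r - a + t * (N / (2 * \<alpha>))) (at_right 0)"
      using t by (auto simp: eventually_at_right_field intro!: exI[of _ 1])
    ultimately have "i / \<alpha> \<le> r - a"
      using tendsto_lowerbound[of _ _ "at_right (0::real)"] by fastforce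
    then show ?thesis using a real by (simp add: i_def)
  qed (use ninf in auto)
  then show ?thesis using a by (simp add: subgradient_def)
qed

lemma prox_in_minimizers:
  assumes "prox_defined \<beta> q"
  shows "prox \<beta> q x \<in> minimizers (prox_objective \<beta> q x)"
  using assms someI_ex[of "is_arg_min (prox_objective \<beta> q x) (\<lambda>_. True)"]
  by (auto simp: prox_defined_def minimizers_def prox_def arg_min_def)

lemma resolvent_prox:
  fixes q :: "'a::real_inner \<Rightarrow> ereal"
  assumes "\<alpha> > 0" "ereal_convex q" "\<And>x. q x \<noteq> -\<infinity>" "q x0 \<noteq> \<infinity>" "prox_defined \<alpha> q"
  shows "resolvent \<alpha> (subgradient q) (prox \<alpha> q)"
  unfolding resolvent_def
  using prox_objective_minimizer_subgradient[OF assms(1-4)] prox_in_minimizers[OF assms(5)] by blast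

section \<open>Completing the square in the proximal objective\<close>

lemma is_arg_min_add_const:
  fixes q :: "'a \<Rightarrow> ereal"
  shows "is_arg_min (\<lambda>z. q z + ereal c) P = is_arg_min q P"
proof -
  have "a + ereal c < b + ereal c \<longleftrightarrow> a < b" for a b
    by (cases a; cases b) auto
  then show ?thesis by (auto simp: is_arg_min_def fun_eq_iff)
qed

text \<open>Adding the \<sigma>-term changes the curvature from \<open>1 / \<alpha>\<close> to
  \<open>1 / \<beta>\<close> and moves the centre to
  \<open>(\<beta> / \<alpha>) *\<^sub>R x\<close>, up to a constant in \<open>z\<close>. Equality of
  the predicates, not just of their solution sets up to choice, makes \<open>arg_min\<close> pick
  the same point on both sides.\<close>

lemma is_arg_min_prox_objective_square_shift:
  fixes q :: "'a::real_inner \<Rightarrow> ereal"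
  assumes "\<alpha> > 0" "\<beta> > 0" "1 / \<beta> = 1 / \<alpha> + \<sigma>"
  shows "is_arg_min (prox_objective \<alpha> (\<lambda>z. q z + ereal (\<sigma> / 2 * (norm z)\<^sup>2)) x) P
    = is_arg_min (prox_objective \<beta> q ((\<beta> / \<alpha>) *\<^sub>R x)) P"
proof -
  define c where "c = 1 / (2 * \<alpha>) * (norm x)\<^sup>2 - 1 / (2 * \<beta>) * (norm ((\<beta> / \<alpha>) *\<^sub>R x))\<^sup>2"
  have expand: "(norm (z - s *\<^sub>R x))\<^sup>2 = (norm z)\<^sup>2 - 2 * s * (z \<bullet> x) + (norm (s *\<^sub>R x))\<^sup>2" for z s
    by (simp only: power2_norm_eq_inner) (simp add: inner_diff inner_commute algebra_simps)
  have \<sigma>: "\<sigma> = 1 / \<beta> - 1 / \<alpha>" using assms(3) by simp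
  have "1 / (2 * \<alpha>) * (norm (z - x))\<^sup>2 + \<sigma> / 2 * (norm z)\<^sup>2
      = 1 / (2 * \<beta>) * (norm (z - (\<beta> / \<alpha>) *\<^sub>R x))\<^sup>2 + c" for z
    using assms(1,2) unfolding \<sigma> c_def expand[of z "\<beta> / \<alpha>"] expand[of z 1, simplified]
    by (simp add: field_simps)
  then have "prox_objective \<alpha> (\<lambda>z. q z + ereal (\<sigma> / 2 * (norm z)\<^sup>2)) x z
      = prox_objective \<beta> q ((\<beta> / \<alpha>) *\<^sub>R x) z + ereal c" for z
    by (cases "q z") (simp_all add: prox_objective_def algebra_simps)
  then have "prox_objective \<alpha> (\<lambda>z. q z + ereal (\<sigma> / 2 * (norm z)\<^sup>2)) x
      = (\<lambda>z. prox_objective \<beta> q ((\<beta> / \<alpha>) *\<^sub>R x) z + ereal c)" by (rule ext)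
  then show ?thesis by (simp only: is_arg_min_add_const)
qed

lemma prox_square_shift:
  fixes q :: "'a::real_inner \<Rightarrow> ereal"
  assumes "\<alpha> > 0" "\<beta> > 0" "1 / \<beta> = 1 / \<alpha> + \<sigma>"
  shows "prox \<beta> q ((\<beta> / \<alpha>) *\<^sub>R x) = prox \<alpha> (\<lambda>z. q z + ereal (\<sigma> / 2 * (norm z)\<^sup>2)) x"
  by (simp only: prox_def arg_min_def is_arg_min_prox_objective_square_shift[OF assms])

lemma prox_defined_square_shift:
  fixes q :: "'a::real_inner \<Rightarrow> ereal"
  assumes "\<alpha> > 0" "\<beta> > 0" "1 / \<beta> = 1 / \<alpha> + \<sigma>" "prox_defined \<beta> q"
  shows "prox_defined \<alpha> (\<lambda>z. q z + ereal (\<sigma> / 2 * (norm z)\<^sup>2))"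
  using assms(4) unfolding prox_defined_def minimizers_def
    is_arg_min_prox_objective_square_shift[OF assms(1-3)] by blast

section \<open>Finite convex functions and the sum rule for subgradients\<close>

lemma ereal_convex_ereal:
  assumes "convex_on UNIV G"
  shows "ereal_convex (\<lambda>x. ereal (G x))"
  using assms by (auto simp: ereal_convex_def intro: convex_onD)

text \<open>A finite convex function on a Euclidean space is continuous, so its sublevel sets are
  closed.\<close>

lemma prox_defined_real_convex:
  fixes G :: "'a::euclidean_space \<Rightarrow> real"
  assumes "convex_on UNIV G" "\<alpha> > 0"
  shows "prox_defined \<alpha> (\<lambda>x. ereal (G x))"
proof (rule prox_defined_closed_convex[OF assms(2) _ ereal_convex_ereal[OF assms(1)]])
  have "continuous_on UNIV G" using convex_on_continuous[OF open_UNIV assms(1)] .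
  then have "continuous_on UNIV (\<lambda>x. ereal (G x))" by (intro continuous_intros)
  then show "closed {x. ereal (G x) \<le> a}" for a
    by (intro closed_Collect_le) auto
qed simp

text \<open>The sum rule \<open>\<partial>(F + G) = \<partial>F + \<partial>G\<close> at a minimizer; finiteness of \<open>G\<close> is the constraint
  qualification, excluding a vertical separating hyperplane.\<close>

lemma opposite_subgradients_at_minimizer:
  fixes F :: "'a::euclidean_space \<Rightarrow> ereal" and G :: "'a \<Rightarrow> real"
  assumes F: "ereal_convex F" "\<And>x. F x \<noteq> -\<infinity>" "F p \<noteq> \<infinity>" and G: "convex_on UNIV G"
    and p: "p \<in> minimizers (\<lambda>x. F x + ereal (G x))"
  shows "\<exists>u. subgradient (\<lambda>x. ereal (G x)) p u \<and> subgradient F p (- u)"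
proof -
  obtain a where a: "F p = ereal a" using F(2)[of p] F(3) by (cases "F p") auto
  have min: "F p + ereal (G p) \<le> F x + ereal (G x)" for x
    using p by (auto simp: minimizers_def is_arg_min_def not_less)
  \<comment> \<open>\<open>S\<close> is the strict epigraph of \<open>G\<close>, and
    \<open>H\<close> the hypograph of the minimal value \<open>a + G p\<close> minus
    \<open>F\<close>. A common point would push the sum below its minimum.\<close>
  define S where "S = {(x, t). G x < t}"
  define H where "H = {(x, t). F x \<le> ereal (a + G p - t)}"
  have "convex S"
    unfolding convex_alt
  proof (clarsimp simp: S_def)
    fix x y :: 'a and s t m :: real
    assume st: "G x < s" "G y < t" and m: "0 \<le> m" "m \<le> 1"
    have "G ((1 - m) *\<^sub>R x + m *\<^sub>R y) \<le> (1 - m) * G x + m * G y"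
      using G m by (auto intro: convex_onD)
    also have "\<dots> < (1 - m) * s + m * t"
    proof (cases "m = 0")
      case False
      then have "m * G y < m * t" "(1 - m) * G x \<le> (1 - m) * s"
        using st m by (auto intro: mult_left_mono)
      then show ?thesis by linarith
    qed (use st in simp)
    finally show "G ((1 - m) *\<^sub>R x + m *\<^sub>R y) < (1 - m) * s + m * t" .
  qed
  moreover have "convex H"
    unfolding convex_alt
  proof (clarsimp simp: H_def)
    fix x y :: 'a and s t m :: real
    assume st: "F x \<le> ereal (a + G p - s)" "F y \<le> ereal (a + G p - t)" and m: "0 \<le> m" "m \<le> 1"
    have "F ((1 - m) *\<^sub>R x + m *\<^sub>R y) \<le> ereal (1 - m) * F x + ereal m * F y"
      using F(1) m by (auto simp: ereal_convex_def)
    also have "\<dots> \<le> ereal (1 - m) * ereal (a + G p - s) + ereal m * ereal (a + G p - t)"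
      using st m by (intro add_mono ereal_mult_left_mono) auto
    also have "\<dots> = ereal (a + G p - ((1 - m) * s + m * t))" by (simp add: algebra_simps)
    finally show "F ((1 - m) *\<^sub>R x + m *\<^sub>R y) \<le> ereal (a + G p - ((1 - m) * s + m * t))" .
  qed
  moreover have S: "(x, G x + e) \<in> S" if "e > 0" for x e using that by (simp add: S_def)
  moreover have H: "(x, a + G p - r) \<in> H" if "F x = ereal r" for x r using that by (simp add: H_def)
  moreover have "S \<inter> H = {}"
  proof (clarsimp simp: S_def H_def disjoint_iff)
    fix x t assume "G x < t" "F x \<le> ereal (a + G p - t)"
    then show False using min[of x] a by (cases "F x") auto
  qed
  moreover have "S \<noteq> {}" "H \<noteq> {}" using S[of 1] H[OF a] by auto
  ultimately obtain w b where w: "w \<noteq> 0" "\<forall>x\<in>H. w \<bullet> x \<le> b" "\<forall>x\<in>S. b \<le> w \<bullet> x"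
    using separating_hyperplane_sets[of H S] by blast
  obtain v s where vs: "w = (v, s)" by (cases w)
  have sepS: "b \<le> v \<bullet> x + s * (G x + e)" if "e > 0" for x e
    using w(3) S[OF that, of x] by (force simp: vs)
  have sepH: "v \<bullet> x + s * (a + G p - r) \<le> b" if "F x = ereal r" for x r
    using w(2) H[OF that] by (force simp: vs)
  have p_le: "v \<bullet> p + s * G p \<le> b" using sepH[OF a] by simp
  have s0: "0 \<le> s" using sepS[of 1 p] p_le by (simp add: algebra_simps)
  have "s \<noteq> 0"
  proof
    assume "s = 0"
    \<comment> \<open>For a vertical hyperplane, the finite value of \<open>G\<close> at
      \<open>p - v\<close> puts a point of \<open>S\<close> on the wrong side unless
      \<open>v\<close> is zero.\<close>
    then have "v \<bullet> p \<le> v \<bullet> (p - v)"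
      using p_le sepS[of 1 "p - v"] by simp
    then have "v \<bullet> v \<le> 0" by (simp add: inner_diff_right)
    then have "v = 0" by (metis inner_eq_zero_iff inner_ge_zero order_antisym)
    then show False using \<open>s = 0\<close> w(1) vs by (simp add: zero_prod_def)
  qed
  with s0 have s: "s > 0" by simp
  have sepS0: "b \<le> v \<bullet> x + s * G x" for x
  proof (rule field_le_epsilon)
    fix e :: real assume "e > 0"
    then show "b \<le> v \<bullet> x + s * G x + e"
      using sepS[of "e / s" x] s by (simp add: algebra_simps)
  qed
  have b: "b = v \<bullet> p + s * G p" using sepS0[of p] p_le by simp
  \<comment> \<open>The hyperplane is now the graph of an affine function with slope
    \<open>u\<close> through \<open>(p, G p)\<close>, lying below \<open>G\<close> and above
    \<open>a + G p - F\<close>.\<close>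
  define u where "u = - ((1 / s) *\<^sub>R v)"
  have su: "s * (u \<bullet> x) = - (v \<bullet> x)" for x using s by (simp add: u_def)
  have "G p + u \<bullet> (z - p) \<le> G z" for z
  proof -
    have "s * (G p + u \<bullet> (z - p)) \<le> s * G z"
      using sepS0[of z] unfolding b distrib_left su by (simp add: inner_diff_right)
    then show ?thesis using s by simp
  qed
  then have "subgradient (\<lambda>x. ereal (G x)) p u" by (simp add: subgradient_def)
  moreover have "F p + ereal ((- u) \<bullet> (z - p)) \<le> F z" for z
  proof (cases "F z")
    case (real r)
    have "s * (a - u \<bullet> (z - p)) \<le> s * r"
      using sepH[OF real] unfolding b right_diff_distrib su by (simp add: algebra_simps)
    then show ?thesis using s a real by simp
  qed (use F in auto)
  then have "subgradient F p (- u)" using a by (simp add: subgradient_def)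
  ultimately show ?thesis by blast
qed

text \<open>In the sum of the two subgradient inequalities the linear terms cancel.\<close>

lemma opposite_subgradients_imp_minimizer:
  assumes "subgradient (\<lambda>x. ereal (G x)) p u" "subgradient F p (- u)"
  shows "p \<in> minimizers (\<lambda>x. F x + ereal (G x))"
proof -
  obtain a where a: "F p = ereal a" using assms(2) by (auto simp: subgradient_def)
  have "F p + ereal (G p) \<le> F z + ereal (G z)" for z
  proof -
    have "G p + u \<bullet> (z - p) \<le> G z" using assms(1) by (auto simp: subgradient_def)
    moreover have "ereal (a - u \<bullet> (z - p)) \<le> F z"
      using assms(2) a by (auto simp: subgradient_def)
    ultimately show ?thesis using a by (cases "F z") auto
  qed
  then show ?thesis by (auto simp: minimizers_def is_arg_min_def not_less)
qed

text \<open>The sum rule is applied to \<open>G\<close> plus the characteristic function of the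
  single point \<open>p\<close>, which is trivially minimized at \<open>p\<close>.\<close>

lemma subgradient_exists:
  fixes G :: "'a::euclidean_space \<Rightarrow> real"
  assumes "convex_on UNIV G"
  shows "\<exists>u. subgradient (\<lambda>x. ereal (G x)) p u"
proof -
  define F where "F x = (if x = p then 0 else \<infinity> :: ereal)" for x
  have "ereal_convex F"
    unfolding ereal_convex_def
  proof (intro allI ballI)
    fix x y :: 'a and t :: real assume t: "t \<in> {0..1}"
    have nn: "F x \<ge> 0" "F y \<ge> 0" by (auto simp: F_def)
    \<comment> \<open>At the endpoints \<open>0 * \<infinity> = 0\<close> drops one summand;
      strictly between them, the right side is infinite unless \<open>x\<close> and \<open>y\<close>
      both equal \<open>p\<close>.\<close>
    consider "t = 0" | "t = 1" | "0 < t" "t < 1" using t by force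
    then show "F ((1 - t) *\<^sub>R x + t *\<^sub>R y) \<le> ereal (1 - t) * F x + ereal t * F y"
    proof cases
      case 3
      then show ?thesis by (auto simp: F_def scaleR_left_distrib[symmetric])
    qed (auto simp: zero_ereal_def[symmetric] one_ereal_def[symmetric])
  qed
  moreover have "p \<in> minimizers (\<lambda>x. F x + ereal (G x))"
    by (auto simp: minimizers_def is_arg_min_def F_def)
  ultimately show ?thesis
    using opposite_subgradients_at_minimizer[of F p G] assms by (auto simp: F_def)
qed

section \<open>Reduction to convex summands and both orders of composition\<close>

theorem proposition3:
  fixes f :: "real ^ 'n \<Rightarrow> ereal" and g :: "real ^ 'n \<Rightarrow> real"
    and h :: "real ^ 'n \<Rightarrow> ereal"
    and \<rho> \<alpha> lam \<beta>\<^sub>1 \<beta>\<^sub>2 :: real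
    and K\<^sub>1 K\<^sub>2 :: "real ^ 'n \<Rightarrow> real ^ 'n"
  assumes "\<rho> > 0"
    and "weakly_convex \<rho> g"
    and "\<And>x. f x \<noteq> -\<infinity>"
    and "ereal_convex (\<lambda>x. f x - ereal (\<rho> / 2 * (norm x)\<^sup>2))"
    and "h = (\<lambda>x. f x + ereal (g x))"
    and "minimizers h \<noteq> {}"
    and "0 < \<alpha>" and "\<alpha> < 1 / \<rho>"
    and "\<beta>\<^sub>1 = \<alpha> / (1 + \<alpha> * \<rho>)"
    and "\<beta>\<^sub>2 = \<alpha> / (1 - \<alpha> * \<rho>)"
    and "prox_defined \<beta>\<^sub>2 f"
    and "K\<^sub>1 = (\<lambda>x. prox \<beta>\<^sub>1 (\<lambda>z. ereal (g z)) ((\<beta>\<^sub>1 / \<alpha>) *\<^sub>R x))"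
    and "K\<^sub>2 = (\<lambda>x. prox \<beta>\<^sub>2 f ((\<beta>\<^sub>2 / \<alpha>) *\<^sub>R x))"
    and "0 < lam" and "lam < 1"
  shows "(\<forall>z :: nat \<Rightarrow> real ^ 'n.
            (\<forall>k. z (Suc k) = (1 - lam) *\<^sub>R z k + lam *\<^sub>R (reflected K\<^sub>2 \<circ> reflected K\<^sub>1) (z k))
            \<longrightarrow> (\<exists>z'. z \<longlonglongrightarrow> z' \<and> K\<^sub>1 z' \<in> minimizers h))
       \<and> (\<forall>z :: nat \<Rightarrow> real ^ 'n.
            (\<forall>k. z (Suc k) = (1 - lam) *\<^sub>R z k + lam *\<^sub>R (reflected K\<^sub>1 \<circ> reflected K\<^sub>2) (z k))
            \<longrightarrow> (\<exists>z'. z \<longlonglongrightarrow> z' \<and> K\<^sub>2 z' \<in> minimizers h))"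
proof -
  define G where "G x = g x + \<rho> / 2 * (norm x)\<^sup>2" for x
  \<comment> \<open>Written as adding a negative multiple of the square, to match the square shift
    with \<open>\<sigma> = - \<rho>\<close>.\<close>
  define F where "F x = f x + ereal (- \<rho> / 2 * (norm x)\<^sup>2)" for x
  have G: "convex_on UNIV G" using assms(2) unfolding weakly_convex_def G_def by auto
  have "F = (\<lambda>x. f x - ereal (\<rho> / 2 * (norm x)\<^sup>2))"
    by (simp add: F_def fun_eq_iff minus_ereal_def)
  with assms(4) have F: "ereal_convex F" by simp
  have F_ninf: "F x \<noteq> -\<infinity>" for x using assms(3)[of x] by (simp add: F_def)
  have F_inf: "F x = \<infinity> \<longleftrightarrow> f x = \<infinity>" for x by (simp add: F_def)
  have h: "h = (\<lambda>x. F x + ereal (G x))"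
  proof
    fix x show "h x = F x + ereal (G x)"
      unfolding assms(5) by (cases "f x") (simp_all add: F_def G_def)
  qed
  have \<alpha>\<rho>: "0 < \<alpha> * \<rho>" "\<alpha> * \<rho> < 1" using assms(1,7,8) by (simp_all add: field_simps)
  have \<beta>: "0 < \<beta>\<^sub>1" "0 < \<beta>\<^sub>2" "1 / \<beta>\<^sub>1 = 1 / \<alpha> + \<rho>" "1 / \<beta>\<^sub>2 = 1 / \<alpha> + - \<rho>"
    using \<alpha>\<rho> assms(7) by (simp_all add: assms(9,10) field_simps)
  have K1: "K\<^sub>1 = prox \<alpha> (\<lambda>x. ereal (G x))"
    using prox_square_shift[OF assms(7) \<beta>(1,3), of "\<lambda>z. ereal (g z)"]
    by (simp add: assms(12) G_def fun_eq_iff)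
  have K2: "K\<^sub>2 = prox \<alpha> F"
    using prox_square_shift[OF assms(7) \<beta>(2,4), of f] by (simp add: assms(13) F_def[abs_def] fun_eq_iff)
  have prF: "prox_defined \<alpha> F"
    using prox_defined_square_shift[OF assms(7) \<beta>(2,4) assms(11)] by (simp add: F_def[abs_def])
  have resG: "resolvent \<alpha> (subgradient (\<lambda>x. ereal (G x))) K\<^sub>1"
    unfolding K1 by (rule resolvent_prox[OF assms(7) ereal_convex_ereal[OF G]])
      (use prox_defined_real_convex[OF G assms(7)] in auto)
  \<comment> \<open>\<open>B\<close> abstracts the subdifferential of \<open>F\<close>, so that the
    case of \<open>f\<close> identically \<open>\<infinity>\<close> can supply a different
    relation.\<close>
  have "\<exists>B p u. monotone_rel B \<and> resolvent \<alpha> B K\<^sub>2 \<and> subgradient (\<lambda>x. ereal (G x)) p u \<and> B p (- u) \<and>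
    (\<forall>p u. subgradient (\<lambda>x. ereal (G x)) p u \<longrightarrow> B p (- u) \<longrightarrow> p \<in> minimizers h)"
  proof (cases "\<exists>x. f x \<noteq> \<infinity>")
    case True
    then obtain x0 where x0: "F x0 \<noteq> \<infinity>" using F_inf by auto
    obtain p where p: "p \<in> minimizers h" using assms(6) by auto
    then have "h p \<le> h x0" by (auto simp: minimizers_def is_arg_min_def not_less)
    then have "F p \<noteq> \<infinity>" using x0 by (auto simp: h)
    then obtain u where "subgradient (\<lambda>x. ereal (G x)) p u" "subgradient F p (- u)"
      using opposite_subgradients_at_minimizer[OF F F_ninf _ G] p h by auto
    moreover have "resolvent \<alpha> (subgradient F) K\<^sub>2"
      unfolding K2 by (rule resolvent_prox[OF assms(7) F F_ninf x0 prF])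
    ultimately show ?thesis
      using monotone_subgradient[of F] opposite_subgradients_imp_minimizer[of G _ _ F]
      unfolding h by blast
  next
    case False
    \<comment> \<open>If \<open>f\<close> is identically \<open>\<infinity>\<close>, every point minimizes \<open>h\<close>, and \<open>arg_min\<close> makes \<open>K\<^sub>2\<close> constant:
      it is the projection onto some point \<open>c\<close>, hence the resolvent of \<open>\<lambda>p u. p = c\<close>.\<close>
    then have "F = (\<lambda>_. \<infinity>)" using F_inf by auto
    then have "prox_objective \<alpha> F x = (\<lambda>_. \<infinity>)" for x
      by (simp add: prox_objective_def fun_eq_iff)
    then obtain c where c: "K\<^sub>2 = (\<lambda>_. c)" by (auto simp: K2 prox_def fun_eq_iff)
    \<comment> \<open>Any subgradient of \<open>G\<close> at \<open>c\<close> will do, since the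
      relation \<open>p = c\<close> accepts every second argument.\<close>
    obtain u where "subgradient (\<lambda>x. ereal (G x)) c u" using subgradient_exists[OF G] by blast
    moreover have "minimizers h = UNIV"
      using False by (auto simp: assms(5) minimizers_def is_arg_min_def)
    ultimately show ?thesis
      by (intro exI[of _ "\<lambda>p u. p = c"] exI[of _ c] exI[of _ u])
        (auto simp: monotone_rel_def resolvent_def c)
  qed
  then obtain B p u where B: "monotone_rel B" "resolvent \<alpha> B K\<^sub>2"
    and sol: "subgradient (\<lambda>x. ereal (G x)) p u" "B p (- u)"
    and min: "\<And>p u. subgradient (\<lambda>x. ereal (G x)) p u \<Longrightarrow> B p (- u) \<Longrightarrow> p \<in> minimizers h"
    by blast
  note A = monotone_subgradient[of "\<lambda>x. ereal (G x)"] resG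
  show ?thesis
  proof (intro conjI allI impI)
    fix z :: "nat \<Rightarrow> real ^ 'n"
    assume "\<forall>k. z (Suc k) = (1 - lam) *\<^sub>R z k + lam *\<^sub>R (reflected K\<^sub>2 \<circ> reflected K\<^sub>1) (z k)"
    then show "\<exists>z'. z \<longlonglongrightarrow> z' \<and> K\<^sub>1 z' \<in> minimizers h"
      using douglas_rachford[OF A B assms(7) sol assms(14,15), of z] min by blast
  next
    fix z :: "nat \<Rightarrow> real ^ 'n"
    assume "\<forall>k. z (Suc k) = (1 - lam) *\<^sub>R z k + lam *\<^sub>R (reflected K\<^sub>1 \<circ> reflected K\<^sub>2) (z k)"
    \<comment> \<open>With the roles swapped the solution pair starts from \<open>- u\<close>, so
      its opposite is \<open>- (- u)\<close>.\<close>
    moreover have "subgradient (\<lambda>x. ereal (G x)) p (- (- u))" using sol by simp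
    ultimately obtain z' v where z': "z \<longlonglongrightarrow> z'" "B (K\<^sub>2 z') v"
      "subgradient (\<lambda>x. ereal (G x)) (K\<^sub>2 z') (- v)"
      using douglas_rachford[OF B A assms(7) sol(2) _ assms(14,15), of z] by blast
    with min[of "K\<^sub>2 z'" "- v"] show "\<exists>z'. z \<longlonglongrightarrow> z' \<and> K\<^sub>2 z' \<in> minimizers h" by auto
  qed
qed

end
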